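(* Let $K$ be an algebraically closed field, $G$ a finite group, $D=D(G)$ its Drinfel'd double, $L=D^*$ and $g\ge1$. Let $\rho_R$ and $\rho_{\tilde R}$ be the representations of the mapping class group $\Gamma_{g,1}$ on $L^{\otimes g}$ coming from the standard R-matrix $R$ and from the alternative R-matrix $\tilde R$ of $D$, respectively, and let $\mathfrak U\colon L^{\otimes g}\to L^{\otimes g}$ be the linear map defined in the context. Then $\mathfrak U$ is an isomorphism from the $\Gamma_{g,1}$-action on $L^{\otimes g}$ coming from $R$ to the one coming from $\tilde R$; that is, $\mathfrak U$ is bijective and $\mathfrak U\circ\rho_R(\gamma)=\rho_{\tilde R}(\gamma)\circ\mathfrak U$ for all $\gamma\in\Gamma_{g,1}$.
   Context: Let $e$ be the unit of $G$, $[a,b]=aba^{-1}b^{-1}$, $H=K[G]$. $D=D(G)$ has basis $\delta_a\otimes b$ ($a,b\in G$) with product $(\delta_a\otimes b)(\delta_c\otimes d)=\delta_{a,bcb^{-1}}\,\delta_a\otimes bd$ and coproduct $\Delta(\delta_a\otimes b)=\sum_{c}(\delta_c\otimes b)\otimes(\delta_{ac^{-1}}\otimes b)$. Its standard R-matrix is $R=\sum_{a,b}(\delta_b\otimes a)\otimes(\delta_a\otimes e)$ and its alternative R-matrix is $\tilde R=\sum_{a,b}(\delta_a\otimes e)\otimes(\delta_b\otimes a^{-1})$. $L=D^*$ has the dual basis $u(a,b)$, $a,b\in G$, and is an $H$-module by $h.u(a,b)=u(hah^{-1},hbh^{-1})$; tensor products of $H$-modules carry the diagonal action. Define linear bijections: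 $\mathfrak T(u(a,b))=u(a,a^{-1}b)$, $\mathfrak S(u(a,b))=u(ab^{-1}a^{-1},a)$, $\mathfrak B(u(a,b))=u(a^{-1},aba^{-1})$ on $L$, and on $L\otimes L$, $\mathfrak N(u(a,b)\otimes u(a',b'))=u(a,bn^{-1})\otimes u(na'n^{-1},nb')$ with $n=a'^{-1}b^{-1}ab$. For an $H$-module $V$ let $\mathfrak C_V\colon L\otimes V\to L\otimes V$ be given by $\mathfrak C_V(u(a,b)\otimes v)=u(a,b)\otimes[b^{-1},a].v$, so $\mathfrak C_V^{-1}(u(a,b)\otimes v)=u(a,b)\otimes[a,b^{-1}].v$. Define $\mathfrak G_1=\mathrm{id}_L$, $\mathfrak G_2=\mathfrak C_L^{-1}$, and recursively $\mathfrak G_g=\mathfrak C_{L^{\otimes(g-1)}}^{-1}\circ(\mathrm{id}_L\otimes\mathfrak G_{g-1})$ for $g>2$. Finally $\mathfrak U=\mathfrak B^{\otimes g}\circ\mathfrak G_g$. $\Gamma_{g,1}$ is the mapping class group of the compact oriented surface $\Sigma_{g,1}$ of genus $g$ with one boundary component (orientation-preserving diffeomorphisms fixing the boundary pointwise, modulo isotopies doing the same). It acts faithfully on the fundamental group of $\Sigma_{g,1}$ based at a boundary point, a free group on $\alpha_1,\beta_1,\dots,\alpha_g,\beta_g$ in which the boundary is represented by $[\alpha_1,\beta_1]\cdots[\alpha_g,\beta_g]$ (up to orientation). It is generated by classes $\mathfrak t_i,\mathfrak s_i$ ($1\le i\le g$) and $\mathfrak n_l$ ($1\le l\le g-1$),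 where (generators of the free group not mentioned are fixed) $\mathfrak t_i\colon\beta_i\mapsto\beta_i\alpha_i$; $\mathfrak s_i\colon\alpha_i\mapsto\alpha_i\beta_i\alpha_i^{-1},\ \beta_i\mapsto\alpha_i^{-1}$; $\mathfrak n_l\colon\beta_l\mapsto\mu_l\beta_l,\ \alpha_{l+1}\mapsto\mu_l\alpha_{l+1}\mu_l^{-1},\ \beta_{l+1}\mapsto\beta_{l+1}\mu_l^{-1}$ with $\mu_l=\alpha_{l+1}^{-1}\beta_l\alpha_l\beta_l^{-1}$. Set $\mathfrak T_i=\mathrm{id}_{L^{\otimes(i-1)}}\otimes\mathfrak T\otimes\mathrm{id}_{L^{\otimes(g-i)}}$, $\mathfrak S_i=\mathrm{id}_{L^{\otimes(i-1)}}\otimes\mathfrak S\otimes\mathrm{id}_{L^{\otimes(g-i)}}$, $\mathfrak N_l=\mathrm{id}_{L^{\otimes(l-1)}}\otimes\mathfrak N\otimes\mathrm{id}_{L^{\otimes(g-l-1)}}$. By Lyubashenko's construction there are representations of $\Gamma_{g,1}$ on $L^{\otimes g}$: $\rho_R$ sends $\mathfrak t_i,\mathfrak s_i,\mathfrak n_l$ to $\mathfrak T_i,\mathfrak S_i,\mathfrak N_l$, and $\rho_{\tilde R}$ sends $\mathfrak t_i,\mathfrak s_i,\mathfrak n_l$ to $\mathfrak T_i^{-1},\mathfrak S_i^{-1},\mathfrak N_l^{-1}$. *)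

theory Defs
  imports "HOL-Analysis.Analysis" "HOL-Algebra.Group_Action" "HOL-Algebra.Generated_Groups"
    "HOL-Computational_Algebra.Polynomial"
begin

section \<open>Smooth maps and smooth oriented surfaces in 3-space\<close>

primrec Ck_on :: "nat \<Rightarrow> ('a::real_normed_vector \<Rightarrow> 'b::real_normed_vector) \<Rightarrow> 'a set \<Rightarrow> bool"
  where
    "Ck_on 0 f U \<longleftrightarrow> continuous_on U f"
  | "Ck_on (Suc k) f U \<longleftrightarrow> (\<forall>x\<in>U. f differentiable (at x)) \<and>
       (\<forall>v. Ck_on k (\<lambda>x. frechet_derivative f (at x) v) U)"

definition smooth_on :: "('a::real_normed_vector \<Rightarrow> 'b::real_normed_vector) \<Rightarrow> 'a set \<Rightarrow> bool"
  where "smooth_on f X \<longleftrightarrow>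
    (\<forall>x\<in>X. \<exists>U F. open U \<and> x \<in> U \<and> (\<forall>k. Ck_on k F U) \<and> (\<forall>y\<in>X \<inter> U. F y = f y))"

definition diffeomorphism ::
  "'a::real_normed_vector set \<Rightarrow> 'b::real_normed_vector set \<Rightarrow> ('a \<Rightarrow> 'b) \<Rightarrow> ('b \<Rightarrow> 'a) \<Rightarrow> bool"
  where "diffeomorphism X Y f g \<longleftrightarrow> homeomorphism X Y f g \<and> smooth_on f X \<and> smooth_on g Y"

definition half_plane :: "(real^2) set"
  where "half_plane = {z. 0 \<le> z $ 2}"

definition local_param :: "(real^3) set \<Rightarrow> (real^2) set \<Rightarrow> (real^2 \<Rightarrow> real^3) \<Rightarrow> bool"
  where "local_param S W f \<longleftrightarrow> openin (top_of_set half_plane) W \<and>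
    (\<exists>V g. openin (top_of_set S) V \<and> diffeomorphism W V f g)"

definition smooth_surface :: "(real^3) set \<Rightarrow> bool"
  where "smooth_surface S \<longleftrightarrow> (\<forall>x\<in>S. \<exists>W f. local_param S W f \<and> x \<in> f ` W)"

definition surface_boundary :: "(real^3) set \<Rightarrow> (real^3) set"
  where "surface_boundary S = {x. \<exists>W f z. local_param S W f \<and> z \<in> W \<and> z $ 2 = 0 \<and> f z = x}"

text \<open>The span is needed at boundary points, where the velocities of curves
  starting there only fill a half plane.\<close>

definition tangent_plane :: "(real^3) set \<Rightarrow> real^3 \<Rightarrow> (real^3) set"
  where "tangent_plane S x = span {w. \<exists>c. c 0 = x \<and> c ` {0..1} \<subseteq> S \<and>
    (c has_vector_derivative w) (at 0 within {0..1})}"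

text \<open>An orientation is given by a continuous unit normal field.\<close>

definition unit_normal :: "(real^3) set \<Rightarrow> (real^3 \<Rightarrow> real^3) \<Rightarrow> bool"
  where "unit_normal S \<nu> \<longleftrightarrow> continuous_on S \<nu> \<and>
    (\<forall>x\<in>S. norm (\<nu> x) = 1 \<and> (\<forall>w\<in>tangent_plane S x. \<nu> x \<bullet> w = 0))"

text \<open>On the tangent plane, the linear map \<open>A\<close> below is uniquely determined as the
  differential of \<open>f\<close> at \<open>x\<close>.\<close>

definition orientation_preserving ::
  "(real^3) set \<Rightarrow> (real^3 \<Rightarrow> real^3) \<Rightarrow> (real^3 \<Rightarrow> real^3) \<Rightarrow> bool"
  where "orientation_preserving S \<nu> f \<longleftrightarrow>
    (\<forall>x\<in>S. \<forall>A. \<forall>u\<in>tangent_plane S x. \<forall>v\<in>tangent_plane S x.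
       (f has_derivative A) (at x within S) \<longrightarrow> 0 < \<nu> x \<bullet> cross3 u v \<longrightarrow>
       0 < \<nu> (f x) \<bullet> cross3 (A u) (A v))"


section \<open>The mapping class group\<close>

definition Diff_group :: "(real^3) set \<Rightarrow> (real^3 \<Rightarrow> real^3) \<Rightarrow> (real^3 \<Rightarrow> real^3) monoid"
  where "Diff_group S \<nu> = (BijGroup S)\<lparr>carrier := {f \<in> extensional S.
    (\<exists>f'. diffeomorphism S S f f') \<and> orientation_preserving S \<nu> f \<and>
    (\<forall>x\<in>surface_boundary S. f x = x)}\<rparr>"

definition isotopic_to_id :: "(real^3) set \<Rightarrow> (real^3 \<Rightarrow> real^3) \<Rightarrow> (real^3 \<Rightarrow> real^3) set"
  where "isotopic_to_id S \<nu> = {f \<in> carrier (Diff_group S \<nu>).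
    \<exists>H :: real \<times> (real^3) \<Rightarrow> real^3. smooth_on H ({0..1} \<times> S) \<and>
      (\<forall>t\<in>{0..1}. (\<lambda>x\<in>S. H (t, x)) \<in> carrier (Diff_group S \<nu>)) \<and>
      (\<forall>x\<in>S. H (0, x) = x \<and> H (1, x) = f x)}"

definition mapping_class_group ::
  "(real^3) set \<Rightarrow> (real^3 \<Rightarrow> real^3) \<Rightarrow> (real^3 \<Rightarrow> real^3) set monoid"
  where "mapping_class_group S \<nu> = Diff_group S \<nu> Mod isotopic_to_id S \<nu>"


section \<open>Loops, words in the fundamental group, and the surface of genus g\<close>

datatype gen = Alpha nat | Beta nat

text \<open>The sign \<open>False\<close> marks the inverse of a generator.\<close>

type_synonym word = "(gen \<times> bool) list"

definition gens :: "nat \<Rightarrow> gen set"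
  where "gens g = Alpha ` {1..g} \<union> Beta ` {1..g}"

definition winv :: "word \<Rightarrow> word"
  where "winv w = rev (map (\<lambda>(x, s). (x, \<not> s)) w)"

definition reduced :: "word \<Rightarrow> bool"
  where "reduced w \<longleftrightarrow> successively (\<lambda>(x, s) (y, r). \<not> (x = y \<and> s \<noteq> r)) w"

definition word_path :: "'p::real_normed_vector \<Rightarrow> (gen \<Rightarrow> real \<Rightarrow> 'p) \<Rightarrow> word \<Rightarrow> real \<Rightarrow> 'p"
  where "word_path p \<xi> w =
    foldr (\<lambda>(x, s) q. (if s then \<xi> x else reversepath (\<xi> x)) +++ q) w (linepath p p)"

definition loop_at :: "'p::real_normed_vector set \<Rightarrow> 'p \<Rightarrow> (real \<Rightarrow> 'p) \<Rightarrow> bool"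
  where "loop_at S p q \<longleftrightarrow> path q \<and> path_image q \<subseteq> S \<and> pathstart q = p \<and> pathfinish q = p"

definition free_basis_pi1 ::
  "nat \<Rightarrow> 'p::real_normed_vector set \<Rightarrow> 'p \<Rightarrow> (gen \<Rightarrow> real \<Rightarrow> 'p) \<Rightarrow> bool"
  where "free_basis_pi1 g S p \<xi> \<longleftrightarrow> (\<forall>x\<in>gens g. loop_at S p (\<xi> x)) \<and>
    (\<forall>q. loop_at S p q \<longrightarrow>
      (\<exists>!w. reduced w \<and> fst ` set w \<subseteq> gens g \<and> homotopic_paths S q (word_path p \<xi> w)))"

definition boundary_word :: "nat \<Rightarrow> word"
  where "boundary_word g = concat (map (\<lambda>i.
    [(Alpha i, True), (Beta i, True), (Alpha i, False), (Beta i, False)]) [1..<Suc g])"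

text \<open>A compact connected oriented surface whose boundary is one circle, with a base point
  \<open>p\<close> on it and a standard system \<open>\<xi>\<close> of loops. The loops fix the genus: the fundamental
  group of such a surface is free of rank twice the genus. The boundary circle may be
  traversed in either direction.\<close>

definition marked_surface ::
  "nat \<Rightarrow> (real^3) set \<Rightarrow> (real^3 \<Rightarrow> real^3) \<Rightarrow> real^3 \<Rightarrow> (gen \<Rightarrow> real \<Rightarrow> real^3) \<Rightarrow> bool"
  where "marked_surface g S \<nu> p \<xi> \<longleftrightarrow>
    compact S \<and> connected S \<and> smooth_surface S \<and> unit_normal S \<nu> \<and> free_basis_pi1 g S p \<xi> \<and>
    (\<exists>c. simple_path c \<and> pathstart c = p \<and> pathfinish c = p \<and>
         path_image c = surface_boundary S \<and>
         homotopic_paths S c (word_path p \<xi> (boundary_word g)))"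

text \<open>The action of a mapping class on the fundamental group; \<open>\<sigma>\<close> lists the images of the
  generators.\<close>

definition induces ::
  "nat \<Rightarrow> (real^3) set \<Rightarrow> real^3 \<Rightarrow> (gen \<Rightarrow> real \<Rightarrow> real^3) \<Rightarrow>
   (real^3 \<Rightarrow> real^3) set \<Rightarrow> (gen \<Rightarrow> word) \<Rightarrow> bool"
  where "induces g S p \<xi> \<gamma> \<sigma> \<longleftrightarrow>
    (\<forall>f\<in>\<gamma>. \<forall>x\<in>gens g. homotopic_paths S (f \<circ> \<xi> x) (word_path p \<xi> (\<sigma> x)))"

definition id_aut :: "gen \<Rightarrow> word"
  where "id_aut x = [(x, True)]"

definition t_aut :: "nat \<Rightarrow> gen \<Rightarrow> word"
  where "t_aut i = id_aut(Beta i := [(Beta i, True), (Alpha i, True)])"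

definition s_aut :: "nat \<Rightarrow> gen \<Rightarrow> word"
  where "s_aut i = id_aut(
    Alpha i := [(Alpha i, True), (Beta i, True), (Alpha i, False)],
    Beta i := [(Alpha i, False)])"

definition mu_word :: "nat \<Rightarrow> word"
  where "mu_word l = [(Alpha (l + 1), False), (Beta l, True), (Alpha l, True), (Beta l, False)]"

definition n_aut :: "nat \<Rightarrow> gen \<Rightarrow> word"
  where "n_aut l = id_aut(
    Beta l := mu_word l @ [(Beta l, True)],
    Alpha (l + 1) := mu_word l @ [(Alpha (l + 1), True)] @ winv (mu_word l),
    Beta (l + 1) := [(Beta (l + 1), True)] @ winv (mu_word l))"


section \<open>Tensor powers of the dual of the Drinfeld double\<close>

text \<open>The double \<open>D\<close> of the finite group \<open>G\<close> has the basis \<open>\<delta>\<^sub>a \<otimes> b\<close> indexed by pairs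
  \<open>(a, b)\<close>, and \<open>L\<close> is its dual with dual basis \<open>u(a, b)\<close>. An element of \<open>L\<close> is represented by its
  values on the basis of \<open>D\<close>, i.e. by its coordinates with respect to the dual basis; likewise
  an element of the \<open>n\<close>-fold tensor power of \<open>L\<close> by its coordinates with respect to the basis
  \<open>u(a\<^sub>1, b\<^sub>1) \<otimes> \<dots> \<otimes> u(a\<^sub>n, b\<^sub>n)\<close>, which is indexed by lists of pairs.\<close>

type_synonym ('a, 'k) tensor = "('a \<times> 'a) list \<Rightarrow> 'k"

definition ub :: "('a \<times> 'a) list \<Rightarrow> ('a, 'k::field) tensor"
  where "ub xs = (\<lambda>ys. if ys = xs then 1 else 0)"

text \<open>The tensor product of an element of the \<open>m\<close>-th and an element of another tensor power.\<close>

definition tens :: "nat \<Rightarrow> ('a, 'k::field) tensor \<Rightarrow> ('a, 'k) tensor \<Rightarrow> ('a, 'k) tensor"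
  where "tens m v w = (\<lambda>zs. v (take m zs) * w (drop m zs))"

definition linear_map :: "('i \<Rightarrow> 'k::field) set \<Rightarrow> (('i \<Rightarrow> 'k) \<Rightarrow> ('i \<Rightarrow> 'k)) \<Rightarrow> bool"
  where "linear_map V f \<longleftrightarrow> f \<in> V \<rightarrow> V \<and>
    (\<forall>v\<in>V. \<forall>w\<in>V. f (\<lambda>i. v i + w i) = (\<lambda>i. f v i + f w i)) \<and>
    (\<forall>c. \<forall>v\<in>V. f (\<lambda>i. c * v i) = (\<lambda>i. c * f v i))"

definition linear_rep ::
  "('m, 'n) monoid_scheme \<Rightarrow> ('i \<Rightarrow> 'k::field) set \<Rightarrow> ('m \<Rightarrow> ('i \<Rightarrow> 'k) \<Rightarrow> ('i \<Rightarrow> 'k)) \<Rightarrow> bool"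
  where "linear_rep M V \<rho> \<longleftrightarrow> group_action M V \<rho> \<and> (\<forall>\<gamma>\<in>carrier M. linear_map V (\<rho> \<gamma>))"

context
  fixes G :: "('a, 'b) monoid_scheme" (structure)
begin

definition basis :: "nat \<Rightarrow> ('a \<times> 'a) list set"
  where "basis n = {xs. length xs = n \<and> set xs \<subseteq> carrier G \<times> carrier G}"

definition Lpow :: "nat \<Rightarrow> ('a, 'k::field) tensor set"
  where "Lpow n = {w. \<forall>xs. xs \<notin> basis n \<longrightarrow> w xs = 0}"

text \<open>Linear extension of \<open>F\<close>, given on the basis.\<close>

definition linext ::
  "nat \<Rightarrow> (('a \<times> 'a) list \<Rightarrow> ('a, 'k::field) tensor) \<Rightarrow> ('a, 'k) tensor \<Rightarrow> ('a, 'k) tensor"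
  where "linext n F w = (\<lambda>ys. \<Sum>xs\<in>basis n. w xs * F xs ys)"

text \<open>Tensor product of linear endomorphisms of the \<open>m\<close>-th and the \<open>n\<close>-th tensor power.\<close>

definition tmap ::
  "nat \<Rightarrow> nat \<Rightarrow> (('a, 'k::field) tensor \<Rightarrow> ('a, 'k) tensor) \<Rightarrow>
   (('a, 'k) tensor \<Rightarrow> ('a, 'k) tensor) \<Rightarrow> ('a, 'k) tensor \<Rightarrow> ('a, 'k) tensor"
  where "tmap m n f h =
    linext (m + n) (\<lambda>zs. tens m (f (ub (take m zs))) (h (ub (drop m zs))))"

primrec tpow ::
  "nat \<Rightarrow> (('a, 'k::field) tensor \<Rightarrow> ('a, 'k) tensor) \<Rightarrow> ('a, 'k) tensor \<Rightarrow> ('a, 'k) tensor"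
  where
    "tpow 0 f = id"
  | "tpow (Suc n) f = tmap 1 n f (tpow n f)"

definition gcomm :: "'a \<Rightarrow> 'a \<Rightarrow> 'a"
  where "gcomm a b = a \<otimes> b \<otimes> inv a \<otimes> inv b"

definition frakT :: "('a, 'k::field) tensor \<Rightarrow> ('a, 'k) tensor"
  where "frakT = linext 1 (\<lambda>xs. case hd xs of (a, b) \<Rightarrow> ub [(a, inv a \<otimes> b)])"

definition frakS :: "('a, 'k::field) tensor \<Rightarrow> ('a, 'k) tensor"
  where "frakS = linext 1 (\<lambda>xs. case hd xs of (a, b) \<Rightarrow> ub [(a \<otimes> inv b \<otimes> inv a, a)])"

definition frakB :: "('a, 'k::field) tensor \<Rightarrow> ('a, 'k) tensor"
  where "frakB = linext 1 (\<lambda>xs. case hd xs of (a, b) \<Rightarrow> ub [(inv a, a \<otimes> b \<otimes> inv a)])"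

definition frakN :: "('a, 'k::field) tensor \<Rightarrow> ('a, 'k) tensor"
  where "frakN = linext 2 (\<lambda>xs. case (xs ! 0, xs ! 1) of ((a, b), (a', b')) \<Rightarrow>
    (let n = inv a' \<otimes> inv b \<otimes> a \<otimes> b
     in ub [(a, b \<otimes> inv n), (n \<otimes> a' \<otimes> inv n, n \<otimes> b')]))"

text \<open>The diagonal action of a group element \<open>h\<close> on the \<open>n\<close>-th tensor power.\<close>

definition Lact :: "nat \<Rightarrow> 'a \<Rightarrow> ('a, 'k::field) tensor \<Rightarrow> ('a, 'k) tensor"
  where "Lact n h =
    linext n (\<lambda>xs. ub (map (\<lambda>(a, b). (h \<otimes> a \<otimes> inv h, h \<otimes> b \<otimes> inv h)) xs))"

text \<open>The map \<open>\<CC>\<^sub>V\<close> for \<open>V\<close> the \<open>n\<close>-th tensor power of \<open>L\<close>.\<close>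

definition frakC :: "nat \<Rightarrow> ('a, 'k::field) tensor \<Rightarrow> ('a, 'k) tensor"
  where "frakC n = linext (Suc n) (\<lambda>xs. case hd xs of (a, b) \<Rightarrow>
    tens 1 (ub [(a, b)]) (Lact n (gcomm (inv b) a) (ub (tl xs))))"

definition frakC_inv :: "nat \<Rightarrow> ('a, 'k::field) tensor \<Rightarrow> ('a, 'k) tensor"
  where "frakC_inv n = inv_into (Lpow (Suc n)) (frakC n)"

text \<open>Only the cases with positive \<open>g\<close> are meaningful.\<close>

fun frakG :: "nat \<Rightarrow> ('a, 'k::field) tensor \<Rightarrow> ('a, 'k) tensor"
  where
    "frakG 0 = id"
  | "frakG (Suc 0) = id"
  | "frakG (Suc (Suc 0)) = frakC_inv 1"
  | "frakG (Suc (Suc (Suc n))) =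
       frakC_inv (Suc (Suc n)) \<circ> tmap 1 (Suc (Suc n)) id (frakG (Suc (Suc n)))"

definition frakU :: "nat \<Rightarrow> ('a, 'k::field) tensor \<Rightarrow> ('a, 'k) tensor"
  where "frakU g = tpow g frakB \<circ> frakG g"

definition frakT_at :: "nat \<Rightarrow> nat \<Rightarrow> ('a, 'k::field) tensor \<Rightarrow> ('a, 'k) tensor"
  where "frakT_at g i = tmap (i - 1) (1 + (g - i)) id (tmap 1 (g - i) frakT id)"

definition frakS_at :: "nat \<Rightarrow> nat \<Rightarrow> ('a, 'k::field) tensor \<Rightarrow> ('a, 'k) tensor"
  where "frakS_at g i = tmap (i - 1) (1 + (g - i)) id (tmap 1 (g - i) frakS id)"

definition frakN_at :: "nat \<Rightarrow> nat \<Rightarrow> ('a, 'k::field) tensor \<Rightarrow> ('a, 'k) tensor"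
  where "frakN_at g l = tmap (l - 1) (2 + (g - l - 1)) id (tmap 2 (g - l - 1) frakN id)"

text \<open>Lyubashenko's representations for the standard and for the alternative R-matrix
  of the double. Here \<open>M\<close> is the mapping class group and \<open>t\<close>, \<open>s\<close>, \<open>n\<close> are the families of
  its generators, so that in each case there is exactly one representation with the given values.\<close>

definition is_rho_R ::
  "nat \<Rightarrow> 'm monoid \<Rightarrow> (nat \<Rightarrow> 'm) \<Rightarrow> (nat \<Rightarrow> 'm) \<Rightarrow> (nat \<Rightarrow> 'm) \<Rightarrow>
   ('m \<Rightarrow> ('a, 'k::field) tensor \<Rightarrow> ('a, 'k) tensor) \<Rightarrow> bool"
  where "is_rho_R g M t s n \<rho> \<longleftrightarrow> linear_rep M (Lpow g) \<rho> \<and>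
    (\<forall>i\<in>{1..g}. \<forall>w\<in>Lpow g. \<rho> (t i) w = frakT_at g i w \<and> \<rho> (s i) w = frakS_at g i w) \<and>
    (\<forall>l\<in>{1..<g}. \<forall>w\<in>Lpow g. \<rho> (n l) w = frakN_at g l w)"

definition is_rho_R_alt ::
  "nat \<Rightarrow> 'm monoid \<Rightarrow> (nat \<Rightarrow> 'm) \<Rightarrow> (nat \<Rightarrow> 'm) \<Rightarrow> (nat \<Rightarrow> 'm) \<Rightarrow>
   ('m \<Rightarrow> ('a, 'k::field) tensor \<Rightarrow> ('a, 'k) tensor) \<Rightarrow> bool"
  where "is_rho_R_alt g M t s n \<rho> \<longleftrightarrow> linear_rep M (Lpow g) \<rho> \<and>
    (\<forall>i\<in>{1..g}. \<forall>w\<in>Lpow g.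
       \<rho> (t i) w = inv_into (Lpow g) (frakT_at g i) w \<and>
       \<rho> (s i) w = inv_into (Lpow g) (frakS_at g i) w) \<and>
    (\<forall>l\<in>{1..<g}. \<forall>w\<in>Lpow g. \<rho> (n l) w = inv_into (Lpow g) (frakN_at g l) w)"

end

end

theory Submission
  imports Defs
begin

text \<open>A basis element \<open>u(a\<^sub>1, b\<^sub>1) \<otimes> \<dots> \<otimes> u(a\<^sub>g, b\<^sub>g)\<close> can be read as the homomorphism from the free
  group on \<open>\<alpha>\<^sub>i\<close>, \<open>\<beta>\<^sub>i\<close> to \<open>G\<close> with \<open>\<alpha>\<^sub>i \<mapsto> a\<^sub>i\<close> and \<open>\<beta>\<^sub>i \<mapsto> b\<^sub>i\<^sup>-\<^sup>1\<close>. Under this reading the maps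
  \<open>\<TT>\<^sub>i\<close>, \<open>\<SS>\<^sub>i\<close>, \<open>\<NN>\<^sub>l\<close> permute the basis by precomposition with the automorphisms of the free group
  that describe the generators \<open>t\<^sub>i\<close>, \<open>s\<^sub>i\<close>, \<open>n\<^sub>l\<close>, and \<open>\<UU>\<close> permutes it by precomposition
  with an automorphism that sends the boundary word to its inverse, as an orientation-reversing
  homeomorphism of the surface would do. Conjugation with that automorphism inverts each of
  the generators, and this is what turns the values for \<open>R\<close> into those for the alternative
  R-matrix.

  Since the generators generate and both sides are representations, it suffices to treat
  them one at a time (\<open>intertwines_on_generate\<close>). Since all maps involved permute the basis,
  the identity \<open>\<UU> F = F\<^sup>-\<^sup>1 \<UU>\<close> for such a map \<open>F\<close> amounts to \<open>f (u (f xs)) = u xs\<close> for the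
  underlying maps of lists (\<open>intertwines_inverse\<close>). This identity is reduced to one or two
  tensor factors: with \<open>c\<^sub>i = [a\<^sub>i, b\<^sub>i\<^sup>-\<^sup>1]\<close>, the map \<open>u\<close> conjugates the \<open>i\<close>-th factor by
  \<open>c\<^sub>1 \<dots> c\<^sub>i\<^sub>-\<^sub>1\<close> and then applies \<open>\<BB>\<close> to it (\<open>umove_append\<close>). A map of a block of adjacent factors
  that commutes with conjugation and preserves the product of the \<open>c\<^sub>i\<close> over the block thus does
  not interfere with what \<open>u\<close> does outside the block (\<open>inverted_move_at_position\<close>). What remains is
  a calculation with words in \<open>G\<close> for \<open>\<TT>\<close>, \<open>\<SS>\<close> and \<open>\<NN>\<close>, in which the product of the \<open>c\<^sub>i\<close> is
  preserved because mapping classes fix the boundary.\<close>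

locale finite_group = group G for G (structure) +
  assumes finite_carrier: "finite (carrier G)"
begin

section \<open>Linear maps induced by maps of the basis\<close>

text \<open>The equation is only demanded on the tensor power itself, because the inverses that occur in
  the definition of \<open>\<UU>\<close> are unspecified outside it.\<close>

definition acts_as ::
  "nat \<Rightarrow> (('a, 'k::field) tensor \<Rightarrow> ('a, 'k) tensor) \<Rightarrow>
   (('a \<times> 'a) list \<Rightarrow> ('a \<times> 'a) list) \<Rightarrow> bool"
  where "acts_as n F f \<longleftrightarrow> f \<in> basis G n \<rightarrow> basis G n \<and>
    (\<forall>w\<in>Lpow G n. F w = linext G n (\<lambda>xs. ub (f xs)) w)"

lemma finite_basis: "finite (basis G n)"
proof -
  have "finite {xs. set xs \<subseteq> carrier G \<times> carrier G \<and> length xs = n}"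
    using finite_carrier by (intro finite_lists_length_eq) auto
  moreover have "{xs. set xs \<subseteq> carrier G \<times> carrier G \<and> length xs = n} = basis G n"
    by (auto simp: basis_def)
  ultimately show ?thesis by simp
qed

lemma basis_append_iff:
  "length xs = m \<Longrightarrow> xs @ ys \<in> basis G (m + n) \<longleftrightarrow> xs \<in> basis G m \<and> ys \<in> basis G n"
  by (auto simp: basis_def)

lemma take_in_basis: "zs \<in> basis G (m + n) \<Longrightarrow> take m zs \<in> basis G m"
  by (auto simp: basis_def dest: in_set_takeD)

lemma drop_in_basis: "zs \<in> basis G (m + n) \<Longrightarrow> drop m zs \<in> basis G n"
  by (auto simp: basis_def dest: in_set_dropD)

lemma basis_Suc_cases:
  assumes "zs \<in> basis G (Suc n)"
  obtains a b xs where "zs = (a, b) # xs" "a \<in> carrier G" "b \<in> carrier G" "xs \<in> basis G n"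
  using assms by (cases zs) (auto simp: basis_def)

lemma basis_Suc_iff [simp]:
  "(a, b) # xs \<in> basis G (Suc n) \<longleftrightarrow> a \<in> carrier G \<and> b \<in> carrier G \<and> xs \<in> basis G n"
  by (auto simp: basis_def)

lemma basis_0_iff [simp]: "xs \<in> basis G 0 \<longleftrightarrow> xs = []"
  by (auto simp: basis_def)

lemma linext_cong:
  "(\<And>xs. xs \<in> basis G n \<Longrightarrow> F xs = F' xs) \<Longrightarrow> linext G n F w = linext G n F' w"
  by (simp add: linext_def)

lemma linext_in_Lpow:
  assumes "f \<in> basis G m \<rightarrow> basis G n"
  shows "linext G m (\<lambda>xs. ub (f xs)) w \<in> Lpow G n"
proof -
  have "linext G m (\<lambda>xs. ub (f xs)) w ys = 0" if "ys \<notin> basis G n" for ys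
    unfolding linext_def ub_def
  proof (rule sum.neutral, rule ballI)
    fix xs assume "xs \<in> basis G m"
    then have "ys \<noteq> f xs" using assms that by auto
    then show "w xs * (if ys = f xs then 1 else 0) = 0" by simp
  qed
  then show ?thesis by (simp add: Lpow_def)
qed

lemma linext_ub [simp]:
  "xs \<in> basis G n \<Longrightarrow> linext G n F (ub xs) = F xs"
  by (rule ext) (simp add: linext_def ub_def if_distrib[of "\<lambda>x. x * _"] sum.delta finite_basis cong: if_cong)

lemma linext_id:
  assumes "w \<in> Lpow G n"
  shows "linext G n ub w = w"
proof
  fix ys
  show "linext G n ub w ys = w ys"
    using assms by (auto simp: linext_def ub_def Lpow_def if_distrib sum.delta' finite_basis cong: if_cong)
qed

lemma linext_compose:
  assumes "h \<in> basis G n \<rightarrow> basis G n"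
  shows "linext G n F (linext G n (\<lambda>xs. ub (h xs)) w) = linext G n (\<lambda>xs. F (h xs)) w"
proof
  fix ys
  have "(\<Sum>xs\<in>basis G n. (\<Sum>zs\<in>basis G n. w zs * ub (h zs) xs) * F xs ys)
      = (\<Sum>zs\<in>basis G n. \<Sum>xs\<in>basis G n. w zs * (ub (h zs) xs * F xs ys))"
    by (subst sum.swap) (simp add: sum_distrib_right mult.assoc)
  also have "\<dots> = (\<Sum>zs\<in>basis G n. w zs * linext G n F (ub (h zs)) ys)"
    by (simp add: linext_def sum_distrib_left)
  also have "\<dots> = (\<Sum>zs\<in>basis G n. w zs * F (h zs) ys)"
    using assms by (intro sum.cong) (auto simp: Pi_iff)
  finally show "linext G n F (linext G n (\<lambda>xs. ub (h xs)) w) ys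
      = linext G n (\<lambda>xs. F (h xs)) w ys"
    by (simp add: linext_def)
qed

lemma ub_in_Lpow: "xs \<in> basis G n \<Longrightarrow> ub xs \<in> Lpow G n"
  by (auto simp: Lpow_def ub_def)

lemma acts_asI:
  assumes "\<And>xs. xs \<in> basis G n \<Longrightarrow> f xs \<in> basis G n"
    and "\<And>xs. xs \<in> basis G n \<Longrightarrow> F xs = ub (f xs)"
  shows "acts_as n (linext G n F) f"
  using assms by (auto simp: acts_as_def intro: linext_cong)

lemma acts_as_cong:
  assumes "acts_as n F f" and "\<And>xs. xs \<in> basis G n \<Longrightarrow> f xs = f' xs"
  shows "acts_as n F f'"
  using assms by (auto simp: acts_as_def Pi_iff intro: linext_cong)

lemma acts_as_in_basis: "acts_as n F f \<Longrightarrow> xs \<in> basis G n \<Longrightarrow> f xs \<in> basis G n"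
  by (auto simp: acts_as_def)

lemma acts_as_ub: "acts_as n F f \<Longrightarrow> xs \<in> basis G n \<Longrightarrow> F (ub xs) = ub (f xs)"
  by (simp add: acts_as_def ub_in_Lpow)

lemma acts_as_in_Lpow: "acts_as n F f \<Longrightarrow> w \<in> Lpow G n \<Longrightarrow> F w \<in> Lpow G n"
  by (simp add: acts_as_def linext_in_Lpow)

text \<open>Equations between linear maps are reduced to equations between maps of the basis.\<close>

lemma acts_as_unique:
  assumes "acts_as n F f" "acts_as n F' f'" "\<And>xs. xs \<in> basis G n \<Longrightarrow> f xs = f' xs" "w \<in> Lpow G n"
  shows "F w = F' w"
  using assms by (auto simp: acts_as_def intro: linext_cong)

lemma acts_as_id: "acts_as n id (\<lambda>xs. xs)"
  by (simp add: acts_as_def linext_id)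

lemma acts_as_linext: "f \<in> basis G n \<rightarrow> basis G n \<Longrightarrow> acts_as n (linext G n (\<lambda>xs. ub (f xs))) f"
  by (simp add: acts_as_def)

lemma acts_as_comp:
  assumes "acts_as n F f" "acts_as n H h"
  shows "acts_as n (F \<circ> H) (f \<circ> h)"
  using assms by (auto simp: acts_as_def linext_in_Lpow linext_compose)

text \<open>Finiteness of the basis turns injectivity of \<open>f\<close> into bijectivity, so that no inverse of \<open>f\<close>
  has to be exhibited.\<close>

lemma acts_as_bij:
  fixes F :: "('a, 'k::field) tensor \<Rightarrow> ('a, 'k) tensor"
  assumes F: "acts_as n F f" and f: "inj_on f (basis G n)"
  shows "bij_betw F (Lpow G n) (Lpow G n)"
proof -
  have img: "f ` basis G n = basis G n"
    using F f finite_basis[of n] by (intro endo_inj_surj) (auto simp: acts_as_def)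
  define h where "h = inv_into (basis G n) f"
  have h: "h \<in> basis G n \<rightarrow> basis G n"
    unfolding h_def using img inv_into_into[of _ f "basis G n"] by auto
  define H :: "('a, 'k) tensor \<Rightarrow> ('a, 'k) tensor" where "H = linext G n (\<lambda>xs. ub (h xs))"
  have H: "acts_as n H h"
    unfolding H_def using h by (rule acts_as_linext)
  have "(H \<circ> F) w = id w" if "w \<in> Lpow G n" for w
    using acts_as_comp[OF H F] acts_as_id by (rule acts_as_unique) (simp_all add: h_def f that)
  moreover have "(F \<circ> H) w = id w" if "w \<in> Lpow G n" for w
    using acts_as_comp[OF F H] acts_as_id
    by (rule acts_as_unique) (simp_all add: h_def img f_inv_into_f that)
  ultimately show ?thesis
    using acts_as_in_Lpow[OF F] acts_as_in_Lpow[OF H]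
    by (intro bij_betw_byWitness[where f' = H]) auto
qed

lemma acts_as_inv_into:
  fixes F :: "('a, 'k::field) tensor \<Rightarrow> ('a, 'k) tensor"
  assumes F: "acts_as n F f" and h: "\<And>xs. xs \<in> basis G n \<Longrightarrow> h xs \<in> basis G n"
    and hf: "\<And>xs. xs \<in> basis G n \<Longrightarrow> h (f xs) = xs"
    and fh: "\<And>xs. xs \<in> basis G n \<Longrightarrow> f (h xs) = xs"
  shows "acts_as n (inv_into (Lpow G n) F) h"
proof -
  define H :: "('a, 'k) tensor \<Rightarrow> ('a, 'k) tensor" where "H = linext G n (\<lambda>xs. ub (h xs))"
  have H: "acts_as n H h"
    unfolding H_def using h by (intro acts_as_linext) auto
  have inj: "inj_on F (Lpow G n)"
    using acts_as_bij[OF F] hf by (metis bij_betw_imp_inj_on inj_on_inverseI)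
  have "inv_into (Lpow G n) F w = H w" if w: "w \<in> Lpow G n" for w
  proof (rule inv_into_f_eq[OF inj])
    show "H w \<in> Lpow G n" by (rule acts_as_in_Lpow[OF H w])
    have "(F \<circ> H) w = id w"
      using acts_as_comp[OF F H] acts_as_id by (rule acts_as_unique) (simp_all add: fh w)
    then show "F (H w) = w" by simp
  qed
  then show ?thesis
    using H by (simp add: acts_as_def H_def)
qed

lemma acts_as_linear_map:
  assumes "acts_as n F f"
  shows "linear_map (Lpow G n) F"
proof -
  have "F (\<lambda>i. v i + w i) = (\<lambda>i. F v i + F w i)" if "v \<in> Lpow G n" "w \<in> Lpow G n" for v w
  proof -
    have "(\<lambda>i. v i + w i) \<in> Lpow G n" using that by (simp add: Lpow_def)
    then show ?thesis
      using assms that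
      by (simp add: acts_as_def linext_def sum.distrib[symmetric] distrib_right)
  qed
  moreover have "F (\<lambda>i. c * v i) = (\<lambda>i. c * F v i)" if "v \<in> Lpow G n" for c v
  proof -
    have "(\<lambda>i. c * v i) \<in> Lpow G n" using that by (simp add: Lpow_def)
    then show ?thesis
      using assms that by (simp add: acts_as_def linext_def sum_distrib_left mult.assoc)
  qed
  ultimately show ?thesis
    using acts_as_in_Lpow[OF assms] by (auto simp: linear_map_def)
qed

lemma tens_ub:
  assumes "length xs = m"
  shows "tens m (ub xs) (ub ys) = ub (xs @ ys)"
proof
  fix zs
  have "take m zs = xs \<and> drop m zs = ys \<longleftrightarrow> zs = xs @ ys"
    using assms by (metis append_eq_conv_conj)
  then show "tens m (ub xs) (ub ys) zs = ub (xs @ ys) zs"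
    by (auto simp: tens_def ub_def)
qed

lemma acts_as_tmap:
  assumes F: "acts_as m F f" and H: "acts_as n H h"
  shows "acts_as (m + n) (tmap G m n F H) (\<lambda>zs. f (take m zs) @ h (drop m zs))"
  unfolding tmap_def
proof (rule acts_asI)
  fix zs assume zs: "zs \<in> basis G (m + n)"
  note t = take_in_basis[OF zs] and d = drop_in_basis[OF zs]
  have len: "length (f (take m zs)) = m"
    using acts_as_in_basis[OF F t] by (simp add: basis_def)
  then show "f (take m zs) @ h (drop m zs) \<in> basis G (m + n)"
    using acts_as_in_basis[OF F t] acts_as_in_basis[OF H d] by (simp add: basis_append_iff)
  show "tens m (F (ub (take m zs))) (H (ub (drop m zs))) = ub (f (take m zs) @ h (drop m zs))"
    by (simp add: acts_as_ub[OF F t] acts_as_ub[OF H d] tens_ub len)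
qed

section \<open>The isomorphism as a map of the basis\<close>

lemma inv_mult_cancel_left: "x \<in> carrier G \<Longrightarrow> y \<in> carrier G \<Longrightarrow> inv x \<otimes> (x \<otimes> y) = y"
  by (simp add: m_assoc[symmetric])

lemma mult_inv_cancel_left: "x \<in> carrier G \<Longrightarrow> y \<in> carrier G \<Longrightarrow> x \<otimes> (inv x \<otimes> y) = y"
  by (simp add: m_assoc[symmetric])

text \<open>Together with the simplification rules for groups, these bring a word in elements of the group
  and their inverses into the freely reduced form that is bracketed to the right.\<close>

lemmas word_simps = m_assoc inv_mult_group inv_mult_cancel_left mult_inv_cancel_left

definition conjugate :: "'a \<Rightarrow> ('a \<times> 'a) list \<Rightarrow> ('a \<times> 'a) list"
  where "conjugate h = map (\<lambda>(a, b). (h \<otimes> a \<otimes> inv h, h \<otimes> b \<otimes> inv h))"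

lemma length_conjugate [simp]: "length (conjugate h xs) = length xs"
  by (simp add: conjugate_def)

lemma conjugate_Nil [simp]: "conjugate h [] = []"
  by (simp add: conjugate_def)

lemma conjugate_Cons [simp]:
  "conjugate h ((a, b) # xs) = (h \<otimes> a \<otimes> inv h, h \<otimes> b \<otimes> inv h) # conjugate h xs"
  by (simp add: conjugate_def)

lemma conjugate_append [simp]: "conjugate h (xs @ ys) = conjugate h xs @ conjugate h ys"
  by (simp add: conjugate_def)

lemma conjugate_in_basis: "h \<in> carrier G \<Longrightarrow> xs \<in> basis G n \<Longrightarrow> conjugate h xs \<in> basis G n"
  by (auto simp: basis_def conjugate_def)

lemma conjugate_conjugate:
  "h \<in> carrier G \<Longrightarrow> k \<in> carrier G \<Longrightarrow> xs \<in> basis G n \<Longrightarrow>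
    conjugate h (conjugate k xs) = conjugate (h \<otimes> k) xs"
  by (auto simp: basis_def conjugate_def word_simps)

lemma conjugate_one: "xs \<in> basis G n \<Longrightarrow> conjugate \<one> xs = xs"
  by (auto simp: basis_def conjugate_def intro!: map_idI)

lemma inj_conjugate: "h \<in> carrier G \<Longrightarrow> inj_on (conjugate h) (basis G n)"
  by (rule inj_on_inverseI[where g = "conjugate (inv h)"]) (simp add: conjugate_conjugate conjugate_one)

text \<open>The value of the boundary word \<open>[\<alpha>\<^sub>1, \<beta>\<^sub>1] [\<alpha>\<^sub>2, \<beta>\<^sub>2] \<dots>\<close> under \<open>\<alpha>\<^sub>i \<mapsto> a\<^sub>i\<close>, \<open>\<beta>\<^sub>i \<mapsto> b\<^sub>i\<^sup>-\<^sup>1\<close>.\<close>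

fun comm_prod :: "('a \<times> 'a) list \<Rightarrow> 'a"
  where
    "comm_prod [] = \<one>"
  | "comm_prod ((a, b) # xs) = gcomm G a (inv b) \<otimes> comm_prod xs"

fun gmove :: "('a \<times> 'a) list \<Rightarrow> ('a \<times> 'a) list"
  where
    "gmove [] = []"
  | "gmove ((a, b) # xs) = (a, b) # conjugate (gcomm G a (inv b)) (gmove xs)"

definition bmove :: "('a \<times> 'a) list \<Rightarrow> ('a \<times> 'a) list"
  where "bmove = map (\<lambda>(a, b). (inv a, a \<otimes> b \<otimes> inv a))"

definition umove :: "('a \<times> 'a) list \<Rightarrow> ('a \<times> 'a) list"
  where "umove xs = bmove (gmove xs)"

lemma gcomm_closed [simp]: "a \<in> carrier G \<Longrightarrow> b \<in> carrier G \<Longrightarrow> gcomm G a b \<in> carrier G"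
  by (simp add: gcomm_def)

lemma comm_prod_closed: "xs \<in> basis G n \<Longrightarrow> comm_prod xs \<in> carrier G"
  by (induction xs arbitrary: n rule: comm_prod.induct) (auto simp: basis_def)

lemma gmove_in_basis: "xs \<in> basis G n \<Longrightarrow> gmove xs \<in> basis G n"
  by (induction n arbitrary: xs) (auto elim!: basis_Suc_cases simp: conjugate_in_basis)

lemma bmove_in_basis: "xs \<in> basis G n \<Longrightarrow> bmove xs \<in> basis G n"
  by (auto simp: basis_def bmove_def)

lemma bmove_conjugate:
  "h \<in> carrier G \<Longrightarrow> xs \<in> basis G n \<Longrightarrow> bmove (conjugate h xs) = conjugate h (bmove xs)"
  by (auto simp: basis_def bmove_def conjugate_def word_simps)

lemma umove_in_basis: "xs \<in> basis G n \<Longrightarrow> umove xs \<in> basis G n"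
  by (simp add: umove_def gmove_in_basis bmove_in_basis)

lemma umove_Nil [simp]: "umove [] = []"
  by (simp add: umove_def bmove_def)

lemma umove_Cons:
  assumes "a \<in> carrier G" "b \<in> carrier G" "xs \<in> basis G n"
  shows "umove ((a, b) # xs) = (inv a, a \<otimes> b \<otimes> inv a) # conjugate (gcomm G a (inv b)) (umove xs)"
  using assms bmove_conjugate[of "gcomm G a (inv b)" "gmove xs" n]
  by (simp add: umove_def gmove_in_basis) (simp add: bmove_def)

text \<open>Since \<open>\<BB>\<close> commutes with conjugation, the successive conjugations by the commutators of \<open>xs\<close>
  compose to a single one, by their product.\<close>

lemma umove_append:
  assumes "xs \<in> basis G m" "ys \<in> basis G n"
  shows "umove (xs @ ys) = umove xs @ conjugate (comm_prod xs) (umove ys)"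
  using assms
proof (induction m arbitrary: xs)
  case 0
  then show ?case by (simp add: conjugate_one[OF umove_in_basis])
next
  case (Suc m)
  from Suc.prems(1) show ?case
  proof (rule basis_Suc_cases)
    fix a b xs' assume xs: "xs = (a, b) # xs'" and c: "a \<in> carrier G" "b \<in> carrier G"
      and xs': "xs' \<in> basis G m"
    have "xs' @ ys \<in> basis G (m + n)"
      using xs' Suc.prems(2) by (auto simp: basis_def)
    then show ?thesis
      using xs c xs' Suc.prems(2) Suc.IH[OF xs']
      by (simp add: umove_Cons[where n = "m + n"] umove_Cons[where n = m]
          conjugate_conjugate[where n = n] umove_in_basis comm_prod_closed)
  qed
qed

text \<open>The first pair of the image determines the first pair \<open>(a, b)\<close>, and hence the commutator by
  which the remaining pairs have been conjugated.\<close>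

lemma inj_umove: "inj_on umove (basis G n)"
proof (induction n)
  case 0
  then show ?case by (simp add: inj_on_def)
next
  case (Suc n)
  show ?case
  proof (rule inj_onI)
    fix xs ys assume "xs \<in> basis G (Suc n)" "ys \<in> basis G (Suc n)" and eq: "umove xs = umove ys"
    then obtain a b xs' c d ys' where xs: "xs = (a, b) # xs'" and ab: "a \<in> carrier G" "b \<in> carrier G"
      and xs': "xs' \<in> basis G n" and ys: "ys = (c, d) # ys'" and cd: "c \<in> carrier G" "d \<in> carrier G"
      and ys': "ys' \<in> basis G n"
      by (metis basis_Suc_cases)
    have "(inv a, a \<otimes> b \<otimes> inv a) # conjugate (gcomm G a (inv b)) (umove xs')
        = (inv c, c \<otimes> d \<otimes> inv c) # conjugate (gcomm G c (inv d)) (umove ys')"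
      using eq unfolding xs ys umove_Cons[OF ab xs'] umove_Cons[OF cd ys'] .
    then have 1: "inv a = inv c" "a \<otimes> b \<otimes> inv a = c \<otimes> d \<otimes> inv c"
      and 2: "conjugate (gcomm G a (inv b)) (umove xs') = conjugate (gcomm G c (inv d)) (umove ys')"
      by (blast dest: list.inject[THEN iffD1] prod.inject[THEN iffD1])+
    have ac: "a = c" using 1(1) ab cd by (metis inv_inv)
    then have bd: "b = d" using 1(2) ab cd
      by (simp only: inv_closed m_closed Units_eq Units_l_cancel right_cancel)
    have "umove xs' = umove ys'"
      using 2 ab ac bd inj_conjugate[of "gcomm G a (inv b)" n] xs' ys'
      by (auto simp: inj_on_def umove_in_basis)
    then show "xs = ys"
      using Suc xs' ys' xs ys ac bd by (auto dest: inj_onD)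
  qed
qed

section \<open>Moves of adjacent factors that are inverted by the isomorphism\<close>

text \<open>The last condition says that \<open>u f u\<^sup>-\<^sup>1 = f\<^sup>-\<^sup>1\<close>; in the chosen form it speaks of neither inverse. The
  conditions on conjugation and on the boundary word make it stable under
  passing to a larger number of factors.\<close>

definition inverted_move :: "nat \<Rightarrow> (('a \<times> 'a) list \<Rightarrow> ('a \<times> 'a) list) \<Rightarrow> bool"
  where "inverted_move k f \<longleftrightarrow> f \<in> basis G k \<rightarrow> basis G k \<and>
    (\<forall>h\<in>carrier G. \<forall>xs\<in>basis G k. f (conjugate h xs) = conjugate h (f xs)) \<and>
    (\<forall>xs\<in>basis G k. comm_prod (f xs) = comm_prod xs \<and> f (umove (f xs)) = umove xs)"

definition at_position ::
  "nat \<Rightarrow> nat \<Rightarrow> (('a \<times> 'a) list \<Rightarrow> ('a \<times> 'a) list) \<Rightarrow> ('a \<times> 'a) list \<Rightarrow> ('a \<times> 'a) list"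
  where "at_position m k f zs = take m zs @ f (take k (drop m zs)) @ drop k (drop m zs)"

lemma at_position_append:
  "length xs = m \<Longrightarrow> length ys = k \<Longrightarrow> at_position m k f (xs @ ys @ zs) = xs @ f ys @ zs"
  by (simp add: at_position_def)

lemma inverted_move_in_basis: "inverted_move k f \<Longrightarrow> xs \<in> basis G k \<Longrightarrow> f xs \<in> basis G k"
  by (auto simp: inverted_move_def)

text \<open>Split the list as \<open>p @ xs @ q\<close>. The map \<open>u\<close> conjugates the block by the product for \<open>p\<close>, with which
  \<open>f\<close> commutes, and it conjugates the image of \<open>q\<close> by the product for \<open>p @ xs\<close>, which \<open>f\<close> does not
  change.\<close>

lemma inverted_move_at_position:
  assumes f: "inverted_move k f" and zs: "zs \<in> basis G (m + (k + r))"
  shows "at_position m k f (umove (at_position m k f zs)) = umove zs"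
proof -
  define p xs q where "p = take m zs" and "xs = take k (drop m zs)" and "q = drop k (drop m zs)"
  have zs_eq: "zs = p @ xs @ q" by (simp add: p_def xs_def q_def del: drop_drop)
  have b: "p \<in> basis G m" "xs \<in> basis G k" "q \<in> basis G r"
    unfolding p_def xs_def q_def
    by (rule take_in_basis[OF zs] take_in_basis[OF drop_in_basis[OF zs]]
        drop_in_basis[OF drop_in_basis[OF zs]])+
  note fb = inverted_move_in_basis[OF f]
  have len: "length ys = j" if "ys \<in> basis G j" for ys j
    using that by (simp add: basis_def)
  let ?P = "comm_prod p" and ?X = "comm_prod xs"
  have cl: "?P \<in> carrier G" "?X \<in> carrier G" using b comm_prod_closed by auto
  have split: "umove (p @ ys @ q)
      = umove p @ conjugate ?P (umove ys) @ conjugate ?P (conjugate (comm_prod ys) (umove q))"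
    if "ys \<in> basis G k" for ys
  proof -
    have "ys @ q \<in> basis G (k + r)" using that b by (simp add: basis_append_iff len)
    then show ?thesis
      using that b by (simp add: umove_append[of _ m _ "k + r"] umove_append[of _ k _ r])
  qed
  have cp: "comm_prod (f xs) = ?X" and u: "f (umove (f xs)) = umove xs"
    using f b by (auto simp: inverted_move_def)
  have "at_position m k f zs = p @ f xs @ q"
    by (simp add: zs_eq at_position_append len b)
  then have "at_position m k f (umove (at_position m k f zs))
      = umove p @ f (conjugate ?P (umove (f xs))) @ conjugate ?P (conjugate ?X (umove q))"
    by (simp add: split[OF fb[OF b(2)]] cp at_position_append len umove_in_basis b fb)
  also have "f (conjugate ?P (umove (f xs))) = conjugate ?P (umove xs)"
    using f cl umove_in_basis[OF fb[OF b(2)]] u by (auto simp: inverted_move_def)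
  finally show ?thesis by (simp add: zs_eq split[OF b(2)])
qed

text \<open>From \<open>f u f = u\<close> one gets \<open>F U F = U\<close>. As \<open>u\<close> is injective, so is \<open>f\<close>; hence \<open>F\<close> is bijective and can
  be moved to the other side.\<close>

lemma intertwines_inverse:
  assumes F: "acts_as n F f" and U: "acts_as n U umove"
    and fuf: "\<And>xs. xs \<in> basis G n \<Longrightarrow> f (umove (f xs)) = umove xs" and w: "w \<in> Lpow G n"
  shows "U (F w) = inv_into (Lpow G n) F (U w)"
proof -
  have "inj_on f (basis G n)"
    using fuf inj_umove[of n] by (metis (no_types, lifting) inj_on_def)
  then have inj: "inj_on F (Lpow G n)"
    using acts_as_bij[OF F] by (simp add: bij_betw_def)
  have "(F \<circ> (U \<circ> F)) w = U w"
    using acts_as_comp[OF F acts_as_comp[OF U F]] U by (rule acts_as_unique) (simp_all add: fuf w)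
  then show ?thesis
    using inj w acts_as_in_Lpow[OF F] acts_as_in_Lpow[OF U]
    by (metis comp_apply inv_into_f_f)
qed

definition tmove :: "('a \<times> 'a) list \<Rightarrow> ('a \<times> 'a) list"
  where "tmove xs = (case hd xs of (a, b) \<Rightarrow> [(a, inv a \<otimes> b)])"

definition smove :: "('a \<times> 'a) list \<Rightarrow> ('a \<times> 'a) list"
  where "smove xs = (case hd xs of (a, b) \<Rightarrow> [(a \<otimes> inv b \<otimes> inv a, a)])"

definition nmove :: "('a \<times> 'a) list \<Rightarrow> ('a \<times> 'a) list"
  where "nmove xs = (case (xs ! 0, xs ! 1) of ((a, b), (a', b')) \<Rightarrow>
    (let n = inv a' \<otimes> inv b \<otimes> a \<otimes> b
     in [(a, b \<otimes> inv n), (n \<otimes> a' \<otimes> inv n, n \<otimes> b')]))"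

lemma inverted_move_tmove: "inverted_move 1 tmove"
  by (auto simp: inverted_move_def tmove_def umove_Cons[where n = 0] gcomm_def word_simps
      elim!: basis_Suc_cases)

lemma inverted_move_smove: "inverted_move 1 smove"
  by (auto simp: inverted_move_def smove_def umove_Cons[where n = 0] gcomm_def word_simps
      elim!: basis_Suc_cases)

text \<open>Expanding \<open>f (u (f xs))\<close> for \<open>\<NN>\<close> in one go produces very long words. The two maps are
  therefore given in reduced form, so that free cancellation can take place after each of them.\<close>

lemma nmove_pair:
  assumes "a \<in> carrier G" "b \<in> carrier G" "c \<in> carrier G" "d \<in> carrier G"
  shows "nmove [(a, b), (c, d)] =
    [(a, inv a \<otimes> (b \<otimes> c)),
     (inv c \<otimes> (inv b \<otimes> (a \<otimes> (b \<otimes> (c \<otimes> (inv b \<otimes> (inv a \<otimes> (b \<otimes> c))))))),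
      inv c \<otimes> (inv b \<otimes> (a \<otimes> (b \<otimes> d))))]"
  using assms by (simp add: nmove_def word_simps)

lemma umove_pair:
  assumes "a \<in> carrier G" "b \<in> carrier G" "c \<in> carrier G" "d \<in> carrier G"
  shows "umove [(a, b), (c, d)] =
    [(inv a, a \<otimes> (b \<otimes> inv a)),
     (a \<otimes> (inv b \<otimes> (inv a \<otimes> (b \<otimes> (inv c \<otimes> (inv b \<otimes> (a \<otimes> (b \<otimes> inv a))))))),
      a \<otimes> (inv b \<otimes> (inv a \<otimes> (b \<otimes> (c \<otimes> (d \<otimes> (inv c \<otimes> (inv b \<otimes> (a \<otimes> (b \<otimes> inv a))))))))))]"
  using assms
  by (simp add: umove_Cons[where n = 0] umove_Cons[where n = "Suc 0"] gcomm_def word_simps)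

lemma inverted_move_nmove: "inverted_move 2 nmove"
proof -
  have in_basis: "nmove xs \<in> basis G 2"
    and equivariant: "h \<in> carrier G \<Longrightarrow> nmove (conjugate h xs) = conjugate h (nmove xs)"
    and product: "comm_prod (nmove xs) = comm_prod xs"
    and inverted: "nmove (umove (nmove xs)) = umove xs"
    if "xs \<in> basis G 2" for h xs
  proof -
    from that obtain a b c d where xs: "xs = [(a, b), (c, d)]"
      and abcd: "a \<in> carrier G" "b \<in> carrier G" "c \<in> carrier G" "d \<in> carrier G"
      unfolding numeral_2_eq_2 by (metis basis_0_iff basis_Suc_cases)
    show "nmove xs \<in> basis G 2"
      using abcd by (simp add: xs nmove_pair numeral_2_eq_2)
    show "nmove (conjugate h xs) = conjugate h (nmove xs)" if "h \<in> carrier G"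
      using abcd that unfolding xs by (simp add: nmove_pair, simp add: word_simps)
    show "comm_prod (nmove xs) = comm_prod xs"
      using abcd unfolding xs by (simp add: nmove_pair gcomm_def, simp add: word_simps)
    have "umove (nmove xs) =
      [(inv a, b \<otimes> (c \<otimes> inv a)),
        (a \<otimes> (inv c \<otimes> inv a), a \<otimes> (d \<otimes> (inv c \<otimes> (inv b \<otimes> (a \<otimes> (b \<otimes> inv a))))))]"
      using abcd unfolding xs by (simp add: nmove_pair umove_pair, simp add: word_simps)
    then show "nmove (umove (nmove xs)) = umove xs"
      using abcd unfolding xs by (simp add: nmove_pair umove_pair, simp add: word_simps)
  qed
  then show ?thesis by (simp add: inverted_move_def Pi_iff)
qed

section \<open>The endomorphisms of the tensor powers as maps of the basis\<close>

lemma acts_as_frakT: "acts_as 1 (frakT G) tmove"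
  unfolding frakT_def
  by (rule acts_asI, erule inverted_move_in_basis[OF inverted_move_tmove])
    (simp add: tmove_def split: prod.split)

lemma acts_as_frakS: "acts_as 1 (frakS G) smove"
  unfolding frakS_def
  by (rule acts_asI, erule inverted_move_in_basis[OF inverted_move_smove])
    (simp add: smove_def split: prod.split)

lemma acts_as_frakN: "acts_as 2 (frakN G) nmove"
  unfolding frakN_def
  by (rule acts_asI, erule inverted_move_in_basis[OF inverted_move_nmove])
    (simp add: nmove_def Let_def split: prod.split)

lemma acts_as_at_position:
  assumes "acts_as k F f"
  shows "acts_as (m + (k + r)) (tmap G m (k + r) id (tmap G k r F id)) (at_position m k f)"
  using acts_as_tmap[OF acts_as_id acts_as_tmap[OF assms acts_as_id], of m r]
  by (rule acts_as_cong) (simp add: at_position_def)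

lemma acts_as_Lact: "h \<in> carrier G \<Longrightarrow> acts_as n (Lact G n h) (conjugate h)"
  unfolding Lact_def by (rule acts_asI) (simp_all add: conjugate_in_basis, simp add: conjugate_def)

lemma acts_as_frakB: "acts_as 1 (frakB G) bmove"
  unfolding frakB_def by (rule acts_asI) (auto simp: bmove_def elim!: basis_Suc_cases)

lemma acts_as_tpow_frakB:
  "acts_as n (tpow G n (frakB G :: ('a, 'k::field) tensor \<Rightarrow> ('a, 'k) tensor)) bmove"
proof (induction n)
  case 0
  show ?case unfolding tpow.simps using acts_as_id by (rule acts_as_cong) (simp add: bmove_def)
next
  case (Suc n)
  have "acts_as (Suc n) (tmap G 1 n (frakB G) (tpow G n (frakB G))
      :: ('a, 'k) tensor \<Rightarrow> ('a, 'k) tensor)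
      (\<lambda>zs. bmove (take 1 zs) @ bmove (drop 1 zs))"
    using acts_as_tmap[OF acts_as_frakB Suc] by simp
  then show ?case
    unfolding tpow.simps by (rule acts_as_cong) (auto simp: bmove_def elim!: basis_Suc_cases)
qed

definition cmove :: "('a \<times> 'a) list \<Rightarrow> ('a \<times> 'a) list"
  where "cmove xs = (case hd xs of (a, b) \<Rightarrow> (a, b) # conjugate (gcomm G (inv b) a) (tl xs))"

definition cmove_inv :: "('a \<times> 'a) list \<Rightarrow> ('a \<times> 'a) list"
  where "cmove_inv xs = (case hd xs of (a, b) \<Rightarrow> (a, b) # conjugate (gcomm G a (inv b)) (tl xs))"

lemma gcomm_swap:
  "a \<in> carrier G \<Longrightarrow> b \<in> carrier G \<Longrightarrow> gcomm G a b \<otimes> gcomm G b a = \<one>"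
  by (simp add: gcomm_def word_simps)

lemma acts_as_frakC: "acts_as (Suc n) (frakC G n) cmove"
  unfolding frakC_def
  by (rule acts_asI)
    (auto simp: cmove_def conjugate_in_basis acts_as_ub[OF acts_as_Lact] tens_ub elim!: basis_Suc_cases)

text \<open>The first factor is fixed, so the inverse conjugates by the inverse of the same commutator.\<close>

lemma acts_as_frakC_inv: "acts_as (Suc n) (frakC_inv G n) cmove_inv"
  unfolding frakC_inv_def using acts_as_frakC
  by (rule acts_as_inv_into)
    (auto simp: cmove_def cmove_inv_def conjugate_in_basis conjugate_conjugate gcomm_swap conjugate_one
      elim!: basis_Suc_cases)

text \<open>Unlike the recursion for \<open>\<GG>\<close>, the one for lists starts from the empty list. This changes nothing,
  as there is no factor to the right of the last one that would have to be conjugated.\<close>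

lemma acts_as_frakG:
  "acts_as (Suc n) (frakG G (Suc n) :: ('a, 'k::field) tensor \<Rightarrow> ('a, 'k) tensor) gmove"
proof (induction n)
  case 0
  show ?case
    unfolding frakG.simps using acts_as_id by (rule acts_as_cong) (auto elim!: basis_Suc_cases)
next
  case (Suc n)
  show ?case
  proof (cases n)
    case 0
    have "acts_as (Suc (Suc 0)) (frakG G (Suc (Suc 0)) :: ('a, 'k) tensor \<Rightarrow> ('a, 'k) tensor) gmove"
      unfolding frakG.simps One_nat_def using acts_as_frakC_inv[of "Suc 0"]
      by (rule acts_as_cong) (auto simp: cmove_inv_def elim!: basis_Suc_cases)
    with 0 show ?thesis by simp
  next
    case (Suc m)
    have "acts_as (Suc (Suc n)) (tmap G 1 (Suc n) id (frakG G (Suc n))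
        :: ('a, 'k) tensor \<Rightarrow> ('a, 'k) tensor)
        (\<lambda>zs. take 1 zs @ gmove (drop 1 zs))"
      using acts_as_tmap[OF acts_as_id Suc.IH, of 1] by simp
    from acts_as_comp[OF acts_as_frakC_inv this]
    have "acts_as (Suc (Suc n)) (frakG G (Suc (Suc n)) :: ('a, 'k) tensor \<Rightarrow> ('a, 'k) tensor)
        (cmove_inv \<circ> (\<lambda>zs. take 1 zs @ gmove (drop 1 zs)))"
      by (simp add: Suc)
    then show ?thesis
      by (rule acts_as_cong) (auto simp: cmove_inv_def elim!: basis_Suc_cases)
  qed
qed

lemma acts_as_frakU: "1 \<le> g \<Longrightarrow> acts_as g (frakU G g) umove"
  unfolding frakU_def
  using acts_as_comp[OF acts_as_tpow_frakB acts_as_frakG[of "g - 1"]]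
  by (auto simp: umove_def comp_def elim: acts_as_cong)

lemma frakU_inverts:
  assumes "1 \<le> g" and F: "acts_as k F f" and f: "inverted_move k f" and g: "g = m + (k + r)"
    and w: "w \<in> Lpow G g"
  shows "frakU G g (tmap G m (k + r) id (tmap G k r F id) w)
    = inv_into (Lpow G g) (tmap G m (k + r) id (tmap G k r F id)) (frakU G g w)"
proof (rule intertwines_inverse[OF _ acts_as_frakU[OF \<open>1 \<le> g\<close>] _ w])
  show "acts_as g (tmap G m (k + r) id (tmap G k r F id)) (at_position m k f)"
    unfolding g by (rule acts_as_at_position[OF F])
  show "at_position m k f (umove (at_position m k f xs)) = umove xs" if "xs \<in> basis G g" for xs
    using that unfolding g by (rule inverted_move_at_position[OF f])
qed

end

section \<open>From generators to the whole group\<close>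

text \<open>The set of elements whose actions are intertwined by \<open>U\<close> is closed under products and inverses.\<close>

lemma intertwines_on_generate:
  assumes rep: "group_action M E \<rho>" "group_action M E \<rho>'" and U: "\<And>w. w \<in> E \<Longrightarrow> U w \<in> E"
    and X: "X \<subseteq> carrier M" "\<And>x w. x \<in> X \<Longrightarrow> w \<in> E \<Longrightarrow> U (\<rho> x w) = \<rho>' x (U w)"
    and \<gamma>: "\<gamma> \<in> generate M X" and w: "w \<in> E"
  shows "U (\<rho> \<gamma> w) = \<rho>' \<gamma> (U w)"
  using \<gamma> w
proof (induction \<gamma> arbitrary: w)
  case one
  then show ?case
    using group_action.id_eq_one[OF rep(1)] group_action.id_eq_one[OF rep(2)] U
    by (metis restrict_apply')
next
  case (incl x)
  then show ?case using X by blast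
next
  case (inv x)
  have x: "x \<in> carrier M" using inv(1) X(1) by (rule subsetD[rotated])
  interpret M: group M by (rule group_hom.axioms(1)[OF group_action.group_hom[OF rep(1)]])
  let ?v = "\<rho> (inv\<^bsub>M\<^esub> x) w"
  have v: "?v \<in> E" by (rule group_action.element_image[OF rep(1) M.inv_closed[OF x] inv.prems refl])
  have "\<rho> x ?v = w"
    using group_action.orbit_sym_aux[OF rep(1) M.inv_closed[OF x] inv.prems refl]
    by (simp only: M.inv_inv[OF x])
  then have "\<rho>' x (U ?v) = U w" using X(2)[OF inv(1) v] by (simp only:)
  then show ?case
    by (rule group_action.orbit_sym_aux[OF rep(2) x U[OF v], symmetric])
next
  case (eng x y)
  interpret M: group M by (rule group_hom.axioms(1)[OF group_action.group_hom[OF rep(1)]])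
  have c: "x \<in> carrier M" "y \<in> carrier M"
    using eng.hyps M.generate_in_carrier[OF X(1)] by blast+
  have v: "\<rho> y w \<in> E"
    by (rule group_action.element_image[OF rep(1) c(2) eng.prems refl])
  show ?case
    unfolding group_action.composition_rule[OF rep(1) eng.prems c]
      group_action.composition_rule[OF rep(2) U[OF eng.prems] c]
      eng.IH(1)[OF v] eng.IH(2)[OF eng.prems] ..
qed

theorem theorem4p36:
  fixes G :: "('a, 'b) monoid_scheme"
    and g :: nat
    and S :: "(real^3) set" and \<nu> :: "real^3 \<Rightarrow> real^3"
    and p :: "real^3" and \<xi> :: "gen \<Rightarrow> real \<Rightarrow> real^3"
    and t s n :: "nat \<Rightarrow> (real^3 \<Rightarrow> real^3) set"
    and \<rho> \<rho>' :: "(real^3 \<Rightarrow> real^3) set \<Rightarrow>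
      ('a, 'k::alg_closed_field) tensor \<Rightarrow> ('a, 'k) tensor"
  assumes "group G" and "finite (carrier G)" and "1 \<le> g"
    and "marked_surface g S \<nu> p \<xi>"
    and t: "\<And>i. i \<in> {1..g} \<Longrightarrow> t i \<in> carrier (mapping_class_group S \<nu>) \<and>
      induces g S p \<xi> (t i) (t_aut i)"
    and s: "\<And>i. i \<in> {1..g} \<Longrightarrow> s i \<in> carrier (mapping_class_group S \<nu>) \<and>
      induces g S p \<xi> (s i) (s_aut i)"
    and n: "\<And>l. l \<in> {1..<g} \<Longrightarrow> n l \<in> carrier (mapping_class_group S \<nu>) \<and>
      induces g S p \<xi> (n l) (n_aut l)"
    and generators: "generate (mapping_class_group S \<nu>) (t ` {1..g} \<union> s ` {1..g} \<union> n ` {1..<g})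
      = carrier (mapping_class_group S \<nu>)"
    and "is_rho_R G g (mapping_class_group S \<nu>) t s n \<rho>"
    and "is_rho_R_alt G g (mapping_class_group S \<nu>) t s n \<rho>'"
  shows "linear_map (Lpow G g) (frakU G g) \<and>
    bij_betw (frakU G g) (Lpow G g) (Lpow G g) \<and>
    (\<forall>\<gamma>\<in>carrier (mapping_class_group S \<nu>). \<forall>w\<in>Lpow G g.
       frakU G g (\<rho> \<gamma> w) = \<rho>' \<gamma> (frakU G g w))"
proof -
  interpret finite_group G
    using assms(1,2) by (simp add: finite_group_def finite_group_axioms_def)
  let ?M = "mapping_class_group S \<nu>" and ?U = "frakU G g :: ('a, 'k) tensor \<Rightarrow> ('a, 'k) tensor"
  let ?X = "t ` {1..g} \<union> s ` {1..g} \<union> n ` {1..<g}"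
  note R = \<open>is_rho_R G g ?M t s n \<rho>\<close>[unfolded is_rho_R_def]
    and R' = \<open>is_rho_R_alt G g ?M t s n \<rho>'\<close>[unfolded is_rho_R_alt_def]
  have U: "acts_as g ?U umove" using \<open>1 \<le> g\<close> by (rule acts_as_frakU)
  have on_X: "?U (\<rho> x w) = \<rho>' x (?U w)" if x: "x \<in> ?X" and w: "w \<in> Lpow G g" for x w
  proof -
    have Uw: "?U w \<in> Lpow G g" using acts_as_in_Lpow[OF U w] .
    consider (t) i where "i \<in> {1..g}" "x = t i" | (s) i where "i \<in> {1..g}" "x = s i"
      | (n) l where "l \<in> {1..<g}" "x = n l" using x by blast
    then show ?thesis
    proof cases
      case t
      have "g = (i - 1) + (1 + (g - i))" using t by auto
      from frakU_inverts[OF \<open>1 \<le> g\<close> acts_as_frakT inverted_move_tmove this w]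
      have "?U (frakT_at G g i w) = inv_into (Lpow G g) (frakT_at G g i) (?U w)"
        unfolding frakT_at_def .
      moreover have "\<rho> x w = frakT_at G g i w"
        unfolding t(2) using R t(1) w by blast
      moreover have "\<rho>' x (?U w) = inv_into (Lpow G g) (frakT_at G g i) (?U w)"
        unfolding t(2) using R' t(1) Uw by blast
      ultimately show ?thesis by (simp only:)
    next
      case s
      have "g = (i - 1) + (1 + (g - i))" using s by auto
      from frakU_inverts[OF \<open>1 \<le> g\<close> acts_as_frakS inverted_move_smove this w]
      have "?U (frakS_at G g i w) = inv_into (Lpow G g) (frakS_at G g i) (?U w)"
        unfolding frakS_at_def .
      moreover have "\<rho> x w = frakS_at G g i w"
        unfolding s(2) using R s(1) w by blast
      moreover have "\<rho>' x (?U w) = inv_into (Lpow G g) (frakS_at G g i) (?U w)"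
        unfolding s(2) using R' s(1) Uw by blast
      ultimately show ?thesis by (simp only:)
    next
      case n
      have "g = (l - 1) + (2 + (g - l - 1))" using n by auto
      from frakU_inverts[OF \<open>1 \<le> g\<close> acts_as_frakN inverted_move_nmove this w]
      have "?U (frakN_at G g l w) = inv_into (Lpow G g) (frakN_at G g l) (?U w)"
        unfolding frakN_at_def .
      moreover have "\<rho> x w = frakN_at G g l w"
        unfolding n(2) using R n(1) w by blast
      moreover have "\<rho>' x (?U w) = inv_into (Lpow G g) (frakN_at G g l) (?U w)"
        unfolding n(2) using R' n(1) Uw by blast
      ultimately show ?thesis by (simp only:)
    qed
  qed
  have X: "?X \<subseteq> carrier ?M" using t s n by blast
  have rep: "group_action ?M (Lpow G g) \<rho>" "group_action ?M (Lpow G g) \<rho>'"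
    using conjunct1[OF R] conjunct1[OF R'] by (simp_all only: linear_rep_def)
  have "?U (\<rho> \<gamma> w) = \<rho>' \<gamma> (?U w)" if \<gamma>: "\<gamma> \<in> carrier ?M" and w: "w \<in> Lpow G g" for \<gamma> w
  proof (rule intertwines_on_generate[where U = ?U, OF rep _ X _ _ w])
    show "\<gamma> \<in> generate ?M ?X"
      using \<gamma> generators by (simp only:)
  qed (fact acts_as_in_Lpow[OF U] on_X)+
  \<comment> \<open>Linearity and bijectivity are taken over an arbitrary field, which need not be that of \<open>\<rho>\<close>.\<close>
  then show ?thesis
    using acts_as_linear_map[OF acts_as_frakU] acts_as_bij[OF acts_as_frakU inj_umove] \<open>1 \<le> g\<close>
    by (intro conjI ballI)
qed

end
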